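(* Let $n\ge1$ and let $a\in\mathcal A_n$ be doubly pure. Put $\mathbb H_a=\mathrm{Lin}(e_0,a,\tilde e_0,\tilde a)$. Then there exists a surjective homomorphism $\phi_a:\mathcal A_2\{-n(a),\gamma_{n-1}\}\to\mathbb H_a$, so $\mathbb H_a$ is an associative subalgebra of $\mathcal A_n$.
   Context: Real Cayley–Dickson algebras: $\mathcal A_0=\mathbb R$ with trivial involution. Given nonzero reals $\gamma_0,\gamma_1,\dots$, the algebra $\mathcal A_{k+1}=\mathcal A_{k+1}\{\gamma_0,\dots,\gamma_k\}$ is $\mathcal A_k\times\mathcal A_k$ with componentwise addition and real scaling, product $(a,b)(c,d)=(ac+\gamma_k\bar d b,\ da+b\bar c)$ and involution $\overline{(a,b)}=(\bar a,-b)$. In the notation $\mathcal A_2\{-n(a),\gamma_{n-1}\}$ (same construction with these two parameters) the parameter $-n(a)$ is allowed to be zero. Unity: $e_0$. $\mathrm{Re}(a)=\frac{a+\bar a}{2}$, $n(a)=a\bar a\in\mathbb R$. An element $(a_1,a_2)\in\mathcal A_n$ ($a_1,a_2\in\mathcal A_{n-1}$) is doubly pure if $\mathrm{Re}(a_1)=\mathrm{Re}(a_2)=0$. In $\mathcal A_n$, $\tilde e_0=(0,e_0)$ and $\tilde x=x\tilde e_0$. $\mathrm{Lin}$ is the real linear span. *)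

theory Defs
  imports Complex_Main "HOL-Algebra.Module"
begin

text \<open>
  All the algebras \<open>A\<^sub>k\<close> live in one type of binary trees with real leaves; the elements of
  \<open>A\<^sub>k\<close> are the perfect trees of depth \<open>k\<close>.
\<close>

datatype cd = CD_Real (cd_val: real) | CD_Pair (cd_fst: cd) (cd_snd: cd)

text \<open>
  The records of HOL-Algebra are used only as signatures: nothing is assumed about the operations,
  and multiplication is in general not associative.
\<close>

record 'a star_algebra = "(real, 'a) module" +
  star :: "'a \<Rightarrow> 'a"

definition cd_base :: "cd star_algebra" where
  "cd_base =
    \<lparr>carrier = range CD_Real,
     mult = (\<lambda>x y. CD_Real (cd_val x * cd_val y)),
     one = CD_Real 1,
     zero = CD_Real 0,
     add = (\<lambda>x y. CD_Real (cd_val x + cd_val y)),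
     smult = (\<lambda>r x. CD_Real (r * cd_val x)),
     star = (\<lambda>x. x)\<rparr>"

text \<open>
  The doubling \<open>(a,b)(c,d) = (ac + g d* b, da + b c*)\<close>, \<open>(a,b)* = (a*, -b)\<close>, with arbitrary
  (possibly zero) parameter \<open>g\<close>. Here \<open>(a,b) = x\<close> and \<open>(c,d) = y\<close>.
\<close>

definition cd_double :: "real \<Rightarrow> cd star_algebra \<Rightarrow> cd star_algebra" where
  "cd_double g A =
    \<lparr>carrier = {CD_Pair a b | a b. a \<in> carrier A \<and> b \<in> carrier A},
     mult = (\<lambda>x y. CD_Pair
       ((cd_fst x \<otimes>\<^bsub>A\<^esub> cd_fst y) \<oplus>\<^bsub>A\<^esub> (g \<odot>\<^bsub>A\<^esub> (star A (cd_snd y) \<otimes>\<^bsub>A\<^esub> cd_snd x)))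
       ((cd_snd y \<otimes>\<^bsub>A\<^esub> cd_fst x) \<oplus>\<^bsub>A\<^esub> (cd_snd x \<otimes>\<^bsub>A\<^esub> star A (cd_fst y)))),
     one = CD_Pair \<one>\<^bsub>A\<^esub> \<zero>\<^bsub>A\<^esub>,
     zero = CD_Pair \<zero>\<^bsub>A\<^esub> \<zero>\<^bsub>A\<^esub>,
     add = (\<lambda>x y. CD_Pair (cd_fst x \<oplus>\<^bsub>A\<^esub> cd_fst y) (cd_snd x \<oplus>\<^bsub>A\<^esub> cd_snd y)),
     smult = (\<lambda>r x. CD_Pair (r \<odot>\<^bsub>A\<^esub> cd_fst x) (r \<odot>\<^bsub>A\<^esub> cd_snd x)),
     star = (\<lambda>x. CD_Pair (star A (cd_fst x)) ((-1) \<odot>\<^bsub>A\<^esub> cd_snd x))\<rparr>"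

text \<open>\<open>CD \<gamma> k\<close> is \<open>A\<^sub>k{\<gamma> 0, \<dots>, \<gamma> (k - 1)}\<close>; the other values of \<open>\<gamma>\<close> are irrelevant.\<close>

primrec CD :: "(nat \<Rightarrow> real) \<Rightarrow> nat \<Rightarrow> cd star_algebra" where
  "CD \<gamma> 0 = cd_base"
| "CD \<gamma> (Suc k) = cd_double (\<gamma> k) (CD \<gamma> k)"

definition cd_Re :: "'a star_algebra \<Rightarrow> 'a \<Rightarrow> 'a" where
  "cd_Re A a = (1/2) \<odot>\<^bsub>A\<^esub> (a \<oplus>\<^bsub>A\<^esub> star A a)"

text \<open>The norm is a real number via the identification of \<open>r\<close> with \<open>r e\<^sub>0\<close>.\<close>

definition cd_norm :: "'a star_algebra \<Rightarrow> 'a \<Rightarrow> real" where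
  "cd_norm A a = (THE r. a \<otimes>\<^bsub>A\<^esub> star A a = r \<odot>\<^bsub>A\<^esub> \<one>\<^bsub>A\<^esub>)"

text \<open>The notions below involving \<open>n\<close> are meaningful for \<open>n \<ge> 1\<close> only.\<close>

definition doubly_pure :: "(nat \<Rightarrow> real) \<Rightarrow> nat \<Rightarrow> cd \<Rightarrow> bool" where
  "doubly_pure \<gamma> n a \<longleftrightarrow> a \<in> carrier (CD \<gamma> n) \<and>
    (\<exists>a1 a2. a = CD_Pair a1 a2 \<and>
      cd_Re (CD \<gamma> (n - 1)) a1 = \<zero>\<^bsub>CD \<gamma> (n - 1)\<^esub> \<and>
      cd_Re (CD \<gamma> (n - 1)) a2 = \<zero>\<^bsub>CD \<gamma> (n - 1)\<^esub>)"

definition e0_tilde :: "(nat \<Rightarrow> real) \<Rightarrow> nat \<Rightarrow> cd" where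
  "e0_tilde \<gamma> n = CD_Pair \<zero>\<^bsub>CD \<gamma> (n - 1)\<^esub> \<one>\<^bsub>CD \<gamma> (n - 1)\<^esub>"

definition tilde :: "(nat \<Rightarrow> real) \<Rightarrow> nat \<Rightarrow> cd \<Rightarrow> cd" where
  "tilde \<gamma> n x = x \<otimes>\<^bsub>CD \<gamma> n\<^esub> e0_tilde \<gamma> n"

definition lin_subspace :: "'a star_algebra \<Rightarrow> 'a set \<Rightarrow> bool" where
  "lin_subspace A V \<longleftrightarrow> V \<subseteq> carrier A \<and> \<zero>\<^bsub>A\<^esub> \<in> V \<and>
    (\<forall>x\<in>V. \<forall>y\<in>V. x \<oplus>\<^bsub>A\<^esub> y \<in> V) \<and> (\<forall>r. \<forall>x\<in>V. r \<odot>\<^bsub>A\<^esub> x \<in> V)"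

definition Lin :: "'a star_algebra \<Rightarrow> 'a set \<Rightarrow> 'a set" where
  "Lin A S = lin_subspace A hull S"

definition H_set :: "(nat \<Rightarrow> real) \<Rightarrow> nat \<Rightarrow> cd \<Rightarrow> cd set" where
  "H_set \<gamma> n a = Lin (CD \<gamma> n) {\<one>\<^bsub>CD \<gamma> n\<^esub>, a, e0_tilde \<gamma> n, tilde \<gamma> n a}"

definition unital_subalgebra :: "'a star_algebra \<Rightarrow> 'a set \<Rightarrow> bool" where
  "unital_subalgebra A V \<longleftrightarrow> lin_subspace A V \<and> \<one>\<^bsub>A\<^esub> \<in> V \<and>
    (\<forall>x\<in>V. \<forall>y\<in>V. x \<otimes>\<^bsub>A\<^esub> y \<in> V)"

definition associative_on :: "'a star_algebra \<Rightarrow> 'a set \<Rightarrow> bool" where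
  "associative_on A V \<longleftrightarrow>
    (\<forall>x\<in>V. \<forall>y\<in>V. \<forall>z\<in>V. (x \<otimes>\<^bsub>A\<^esub> y) \<otimes>\<^bsub>A\<^esub> z = x \<otimes>\<^bsub>A\<^esub> (y \<otimes>\<^bsub>A\<^esub> z))"

text \<open>Real-linear, multiplicative and unital maps (\<open>ring_hom\<close> assumes no ring axioms).\<close>

definition alg_hom :: "'a star_algebra \<Rightarrow> 'b star_algebra \<Rightarrow> ('a \<Rightarrow> 'b) set" where
  "alg_hom A B =
    {\<phi> \<in> ring_hom A B. \<forall>r. \<forall>x\<in>carrier A. \<phi> (r \<odot>\<^bsub>A\<^esub> x) = r \<odot>\<^bsub>B\<^esub> \<phi> x}"

end

theory Submission
  imports Defs
begin

text \<open>
  Write \<open>a = (b, c)\<close> with \<open>b\<close>, \<open>c\<close> pure in \<open>A = A\<^sub>n\<^sub>-\<^sub>1\<close> and \<open>g = \<gamma> (n - 1)\<close>. An element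
  \<open>w e\<^sub>0 + x a + y e\<^sub>0~ + z a~\<close> is the pair \<open>(w + x b + z g c, y + x c + z b)\<close>. When two such pairs
  are multiplied, the terms in \<open>b c\<close> and \<open>c b\<close> cancel, and \<open>b b\<close>, \<open>c c\<close> occur only through
  \<open>b b - g (c c) = - n(a) e\<^sub>0\<close>. So neither associativity of \<open>A\<close> nor any relation between \<open>b\<close> and
  \<open>c\<close> is needed, only bilinearity of the product and \<open>x x* \<in> \<real> e\<^sub>0\<close>. Associativity of the image is
  inherited from the four-dimensional algebra.
\<close>

text \<open>
  Elements of a fixed \<open>A\<^sub>k\<close> are determined by their coordinates, so that linear identities in \<open>A\<^sub>k\<close>
  become identities of real numbers.
\<close>

primrec coord :: "cd \<Rightarrow> bool list \<Rightarrow> real" where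
  "coord (CD_Real r) p = r"
| "coord (CD_Pair x y) p =
    (case p of [] \<Rightarrow> 0 | i # q \<Rightarrow> if i then coord y q else coord x q)"

section \<open>Closure of the carriers and coordinates of elements\<close>

lemma CD_closed [simp]:
  "\<one>\<^bsub>CD \<gamma> k\<^esub> \<in> carrier (CD \<gamma> k)"
  "\<zero>\<^bsub>CD \<gamma> k\<^esub> \<in> carrier (CD \<gamma> k)"
  "x \<in> carrier (CD \<gamma> k) \<Longrightarrow> r \<odot>\<^bsub>CD \<gamma> k\<^esub> x \<in> carrier (CD \<gamma> k)"
  "x \<in> carrier (CD \<gamma> k) \<Longrightarrow> star (CD \<gamma> k) x \<in> carrier (CD \<gamma> k)"
  "x \<in> carrier (CD \<gamma> k) \<Longrightarrow> y \<in> carrier (CD \<gamma> k) \<Longrightarrow> x \<oplus>\<^bsub>CD \<gamma> k\<^esub> y \<in> carrier (CD \<gamma> k)"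
  "x \<in> carrier (CD \<gamma> k) \<Longrightarrow> y \<in> carrier (CD \<gamma> k) \<Longrightarrow> x \<otimes>\<^bsub>CD \<gamma> k\<^esub> y \<in> carrier (CD \<gamma> k)"
  by (induction k arbitrary: x y r) (auto simp: cd_base_def cd_double_def)

lemma coord_zero [simp]: "coord \<zero>\<^bsub>CD \<gamma> k\<^esub> p = 0"
  by (induction k arbitrary: p) (auto simp: cd_base_def cd_double_def split: list.splits)

lemma coord_smult [simp]:
  "x \<in> carrier (CD \<gamma> k) \<Longrightarrow> coord (r \<odot>\<^bsub>CD \<gamma> k\<^esub> x) p = r * coord x p"
  by (induction k arbitrary: p x) (auto simp: cd_base_def cd_double_def split: list.splits)

lemma coord_add [simp]:
  "x \<in> carrier (CD \<gamma> k) \<Longrightarrow> y \<in> carrier (CD \<gamma> k) \<Longrightarrow>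
    coord (x \<oplus>\<^bsub>CD \<gamma> k\<^esub> y) p = coord x p + coord y p"
  by (induction k arbitrary: p x y) (auto simp: cd_base_def cd_double_def split: list.splits)

text \<open>The all-\<open>False\<close> path leads to the leaf that carries the real part. This one
  nonzero coordinate is enough to separate the multiples of \<open>e\<^sub>0\<close>.\<close>

lemma coord_one: "coord \<one>\<^bsub>CD \<gamma> k\<^esub> (replicate k False) = 1"
  by (induction k) (auto simp: cd_base_def cd_double_def)

text \<open>Membership in a common carrier fixes the shape of both trees. Across depths coordinates
  do not separate: \<open>CD_Real 0\<close> and \<open>CD_Pair (CD_Real 0) (CD_Real 0)\<close> have
  the same ones.\<close>

lemma coord_eqI:
  assumes "x \<in> carrier (CD \<gamma> k)" "y \<in> carrier (CD \<gamma> k)" "\<And>p. coord x p = coord y p"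
  shows "x = y"
  using assms
proof (induction k arbitrary: x y)
  case 0
  then show ?case by (auto simp: cd_base_def)
next
  case (Suc k)
  then obtain x1 x2 y1 y2 where xy: "x = CD_Pair x1 x2" "y = CD_Pair y1 y2"
    "x1 \<in> carrier (CD \<gamma> k)" "x2 \<in> carrier (CD \<gamma> k)"
    "y1 \<in> carrier (CD \<gamma> k)" "y2 \<in> carrier (CD \<gamma> k)"
    by (auto simp: cd_double_def)
  have "coord x1 p = coord y1 p" for p using Suc.prems(3)[of "False # p"] xy by simp
  moreover have "coord x2 p = coord y2 p" for p using Suc.prems(3)[of "True # p"] xy by simp
  ultimately show ?case using Suc.IH xy by metis
qed

text \<open>Provides the uniqueness behind the definite description in
  \<open>cd_norm\<close>.\<close>

lemma smult_one_inject: "r \<odot>\<^bsub>CD \<gamma> k\<^esub> \<one>\<^bsub>CD \<gamma> k\<^esub> = s \<odot>\<^bsub>CD \<gamma> k\<^esub> \<one>\<^bsub>CD \<gamma> k\<^esub> \<longleftrightarrow> r = s"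
  by (metis coord_one coord_smult CD_closed(1) mult.right_neutral)

section \<open>Linearity of the involution, bilinearity of the product, unit laws\<close>

lemma star_CD [simp]:
  "star (CD \<gamma> k) \<one>\<^bsub>CD \<gamma> k\<^esub> = \<one>\<^bsub>CD \<gamma> k\<^esub>"
  "star (CD \<gamma> k) \<zero>\<^bsub>CD \<gamma> k\<^esub> = \<zero>\<^bsub>CD \<gamma> k\<^esub>"
  "x \<in> carrier (CD \<gamma> k) \<Longrightarrow>
    star (CD \<gamma> k) (r \<odot>\<^bsub>CD \<gamma> k\<^esub> x) = r \<odot>\<^bsub>CD \<gamma> k\<^esub> star (CD \<gamma> k) x"
  "x \<in> carrier (CD \<gamma> k) \<Longrightarrow> y \<in> carrier (CD \<gamma> k) \<Longrightarrow>
    star (CD \<gamma> k) (x \<oplus>\<^bsub>CD \<gamma> k\<^esub> y) = star (CD \<gamma> k) x \<oplus>\<^bsub>CD \<gamma> k\<^esub> star (CD \<gamma> k) y"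
  "x \<in> carrier (CD \<gamma> k) \<Longrightarrow> star (CD \<gamma> k) (star (CD \<gamma> k) x) = x"
proof (induction k arbitrary: x y r)
  case 0
  case 1 then show ?case by (auto simp: cd_base_def algebra_simps)
  case 2 then show ?case by (auto simp: cd_base_def algebra_simps)
  case 3 then show ?case by (auto simp: cd_base_def algebra_simps)
  case 4 then show ?case by (auto simp: cd_base_def algebra_simps)
  case 5 then show ?case by (auto simp: cd_base_def algebra_simps)
next
  case (Suc k)
  case 1 with Suc show ?case
    by (auto simp: cd_double_def algebra_simps intro!: coord_eqI[of _ \<gamma> k])
  case 2 with Suc show ?case
    by (auto simp: cd_double_def algebra_simps intro!: coord_eqI[of _ \<gamma> k])
  case 3 with Suc show ?case
    by (auto simp: cd_double_def algebra_simps intro!: coord_eqI[of _ \<gamma> k])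
  case 4 with Suc show ?case
    by (auto simp: cd_double_def algebra_simps intro!: coord_eqI[of _ \<gamma> k])
  case 5 with Suc show ?case
    by (auto simp: cd_double_def algebra_simps intro!: coord_eqI[of _ \<gamma> k])
qed

text \<open>Both sides go through one induction: the doubling formula reverses the factors in
  \<open>d* b\<close> and \<open>d a\<close>, so homogeneity on one side at level
  \<open>Suc k\<close> uses both sides at level \<open>k\<close>. The same holds for additivity
  below.\<close>

lemma mult_smult_CD [simp]:
  assumes "x \<in> carrier (CD \<gamma> k)" "y \<in> carrier (CD \<gamma> k)"
  shows "(r \<odot>\<^bsub>CD \<gamma> k\<^esub> x) \<otimes>\<^bsub>CD \<gamma> k\<^esub> y = r \<odot>\<^bsub>CD \<gamma> k\<^esub> (x \<otimes>\<^bsub>CD \<gamma> k\<^esub> y)"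
    and "x \<otimes>\<^bsub>CD \<gamma> k\<^esub> (r \<odot>\<^bsub>CD \<gamma> k\<^esub> y) = r \<odot>\<^bsub>CD \<gamma> k\<^esub> (x \<otimes>\<^bsub>CD \<gamma> k\<^esub> y)"
  using assms
proof (induction k arbitrary: x y r)
  case 0
  case 1 then show ?case by (auto simp: cd_base_def algebra_simps)
  case 2 then show ?case by (auto simp: cd_base_def algebra_simps)
next
  case (Suc k)
  case 1 with Suc show ?case
    by (auto simp: cd_double_def algebra_simps intro!: coord_eqI[of _ \<gamma> k])
  case 2 with Suc show ?case
    by (auto simp: cd_double_def algebra_simps intro!: coord_eqI[of _ \<gamma> k])
qed

lemma mult_add_CD [simp]:
  assumes "x \<in> carrier (CD \<gamma> k)" "y \<in> carrier (CD \<gamma> k)" "z \<in> carrier (CD \<gamma> k)"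
  shows "(x \<oplus>\<^bsub>CD \<gamma> k\<^esub> y) \<otimes>\<^bsub>CD \<gamma> k\<^esub> z =
      (x \<otimes>\<^bsub>CD \<gamma> k\<^esub> z) \<oplus>\<^bsub>CD \<gamma> k\<^esub> (y \<otimes>\<^bsub>CD \<gamma> k\<^esub> z)"
    and "z \<otimes>\<^bsub>CD \<gamma> k\<^esub> (x \<oplus>\<^bsub>CD \<gamma> k\<^esub> y) =
      (z \<otimes>\<^bsub>CD \<gamma> k\<^esub> x) \<oplus>\<^bsub>CD \<gamma> k\<^esub> (z \<otimes>\<^bsub>CD \<gamma> k\<^esub> y)"
  using assms
proof (induction k arbitrary: x y z)
  case 0
  case 1 then show ?case by (auto simp: cd_base_def algebra_simps)
  case 2 then show ?case by (auto simp: cd_base_def algebra_simps)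
next
  case (Suc k)
  case 1 with Suc show ?case
    by (auto simp: cd_double_def algebra_simps intro!: coord_eqI[of _ \<gamma> k])
  case 2 with Suc show ?case
    by (auto simp: cd_double_def algebra_simps intro!: coord_eqI[of _ \<gamma> k])
qed

lemma mult_zero_CD [simp]:
  assumes "x \<in> carrier (CD \<gamma> k)"
  shows "\<zero>\<^bsub>CD \<gamma> k\<^esub> \<otimes>\<^bsub>CD \<gamma> k\<^esub> x = \<zero>\<^bsub>CD \<gamma> k\<^esub>" and "x \<otimes>\<^bsub>CD \<gamma> k\<^esub> \<zero>\<^bsub>CD \<gamma> k\<^esub> = \<zero>\<^bsub>CD \<gamma> k\<^esub>"
proof -
  \<comment> \<open>Zero is \<open>0\<close> times any element, so both absorption laws become
    instances of homogeneity.\<close>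
  have zero: "\<zero>\<^bsub>CD \<gamma> k\<^esub> = 0 \<odot>\<^bsub>CD \<gamma> k\<^esub> y" if "y \<in> carrier (CD \<gamma> k)" for y
    using that by (auto intro: coord_eqI[of _ \<gamma> k])
  show "\<zero>\<^bsub>CD \<gamma> k\<^esub> \<otimes>\<^bsub>CD \<gamma> k\<^esub> x = \<zero>\<^bsub>CD \<gamma> k\<^esub>"
    by (metis zero[OF CD_closed(2)] zero[OF CD_closed(6)] mult_smult_CD(1) assms CD_closed(2))
  show "x \<otimes>\<^bsub>CD \<gamma> k\<^esub> \<zero>\<^bsub>CD \<gamma> k\<^esub> = \<zero>\<^bsub>CD \<gamma> k\<^esub>"
    by (metis zero[OF CD_closed(2)] zero[OF CD_closed(6)] mult_smult_CD(2) assms CD_closed(2))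
qed

lemma mult_one_CD [simp]:
  assumes "x \<in> carrier (CD \<gamma> k)"
  shows "\<one>\<^bsub>CD \<gamma> k\<^esub> \<otimes>\<^bsub>CD \<gamma> k\<^esub> x = x" and "x \<otimes>\<^bsub>CD \<gamma> k\<^esub> \<one>\<^bsub>CD \<gamma> k\<^esub> = x"
  using assms
proof (induction k arbitrary: x)
  case 0
  case 1 then show ?case by (auto simp: cd_base_def algebra_simps)
  case 2 then show ?case by (auto simp: cd_base_def algebra_simps)
next
  case (Suc k)
  case 1 with Suc show ?case
    by (auto simp: cd_double_def algebra_simps intro!: coord_eqI[of _ \<gamma> k])
  case 2 with Suc show ?case
    by (auto simp: cd_double_def algebra_simps intro!: coord_eqI[of _ \<gamma> k])
qed

section \<open>Norm and pure elements\<close>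

text \<open>The recursion is \<open>n(a,b) = n(a) - g n(b)\<close>, and the second components
  cancel. Both orders are carried along with a common \<open>r\<close>, because \<open>x x*\<close>
  at level \<open>Suc k\<close> contains \<open>b* b\<close> rather than
  \<open>b b*\<close>.\<close>

lemma mult_star_real:
  assumes "x \<in> carrier (CD \<gamma> k)"
  shows "\<exists>r. x \<otimes>\<^bsub>CD \<gamma> k\<^esub> star (CD \<gamma> k) x = r \<odot>\<^bsub>CD \<gamma> k\<^esub> \<one>\<^bsub>CD \<gamma> k\<^esub> \<and>
    star (CD \<gamma> k) x \<otimes>\<^bsub>CD \<gamma> k\<^esub> x = r \<odot>\<^bsub>CD \<gamma> k\<^esub> \<one>\<^bsub>CD \<gamma> k\<^esub>"
  using assms
proof (induction k arbitrary: x)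
  case 0
  then show ?case by (auto simp: cd_base_def)
next
  case (Suc k)
  then obtain x1 x2 where x: "x = CD_Pair x1 x2"
    "x1 \<in> carrier (CD \<gamma> k)" "x2 \<in> carrier (CD \<gamma> k)"
    by (auto simp: cd_double_def)
  obtain r1 r2 where r:
    "x1 \<otimes>\<^bsub>CD \<gamma> k\<^esub> star (CD \<gamma> k) x1 = r1 \<odot>\<^bsub>CD \<gamma> k\<^esub> \<one>\<^bsub>CD \<gamma> k\<^esub>"
    "star (CD \<gamma> k) x1 \<otimes>\<^bsub>CD \<gamma> k\<^esub> x1 = r1 \<odot>\<^bsub>CD \<gamma> k\<^esub> \<one>\<^bsub>CD \<gamma> k\<^esub>"
    "star (CD \<gamma> k) x2 \<otimes>\<^bsub>CD \<gamma> k\<^esub> x2 = r2 \<odot>\<^bsub>CD \<gamma> k\<^esub> \<one>\<^bsub>CD \<gamma> k\<^esub>"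
    using Suc.IH x by metis
  show ?case
    using x r by (intro exI[of _ "r1 - \<gamma> k * r2"])
      (auto simp: cd_double_def algebra_simps intro!: coord_eqI[of _ \<gamma> k])
qed

lemma mult_star_eq_norm:
  assumes "x \<in> carrier (CD \<gamma> k)"
  shows "x \<otimes>\<^bsub>CD \<gamma> k\<^esub> star (CD \<gamma> k) x = cd_norm (CD \<gamma> k) x \<odot>\<^bsub>CD \<gamma> k\<^esub> \<one>\<^bsub>CD \<gamma> k\<^esub>"
proof -
  obtain r where r: "x \<otimes>\<^bsub>CD \<gamma> k\<^esub> star (CD \<gamma> k) x = r \<odot>\<^bsub>CD \<gamma> k\<^esub> \<one>\<^bsub>CD \<gamma> k\<^esub>"
    using mult_star_real[OF assms] by blast
  then have "cd_norm (CD \<gamma> k) x = r"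
    by (simp add: cd_norm_def smult_one_inject)
  with r show ?thesis by simp
qed

text \<open>Turns purity into a rewrite rule that removes conjugation from products.\<close>

lemma star_pure:
  assumes "x \<in> carrier (CD \<gamma> k)" "cd_Re (CD \<gamma> k) x = \<zero>\<^bsub>CD \<gamma> k\<^esub>"
  shows "star (CD \<gamma> k) x = (-1) \<odot>\<^bsub>CD \<gamma> k\<^esub> x"
proof (rule coord_eqI[of _ \<gamma> k])
  fix p
  have "coord (cd_Re (CD \<gamma> k) x) p = 0" using assms by simp
  then show "coord (star (CD \<gamma> k) x) p = coord ((-1) \<odot>\<^bsub>CD \<gamma> k\<^esub> x) p"
    using assms(1) by (simp add: cd_Re_def)
qed (use assms in auto)

section \<open>Spans of four elements\<close>

text \<open>The coefficients are explicit arguments because the four vectors may be linearly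
  dependent, for instance when \<open>a\<close> is zero; coefficients cannot then be recovered from
  the vector.\<close>

definition lin4 :: "'a star_algebra \<Rightarrow> 'a \<Rightarrow> 'a \<Rightarrow> 'a \<Rightarrow> 'a \<Rightarrow> real \<Rightarrow> real \<Rightarrow> real \<Rightarrow> real \<Rightarrow> 'a" where
  "lin4 A u1 u2 u3 u4 w x y z =
    (w \<odot>\<^bsub>A\<^esub> u1 \<oplus>\<^bsub>A\<^esub> x \<odot>\<^bsub>A\<^esub> u2) \<oplus>\<^bsub>A\<^esub> (y \<odot>\<^bsub>A\<^esub> u3 \<oplus>\<^bsub>A\<^esub> z \<odot>\<^bsub>A\<^esub> u4)"

lemma lin4_CD:
  assumes "u1 \<in> carrier (CD \<gamma> k)" "u2 \<in> carrier (CD \<gamma> k)"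
    "u3 \<in> carrier (CD \<gamma> k)" "u4 \<in> carrier (CD \<gamma> k)"
  shows lin4_closed: "lin4 (CD \<gamma> k) u1 u2 u3 u4 w x y z \<in> carrier (CD \<gamma> k)"
    and coord_lin4: "coord (lin4 (CD \<gamma> k) u1 u2 u3 u4 w x y z) p =
      w * coord u1 p + x * coord u2 p + y * coord u3 p + z * coord u4 p"
  using assms by (auto simp: lin4_def)

lemma lin4_linear:
  assumes "u1 \<in> carrier (CD \<gamma> k)" "u2 \<in> carrier (CD \<gamma> k)"
    "u3 \<in> carrier (CD \<gamma> k)" "u4 \<in> carrier (CD \<gamma> k)"
  defines "h \<equiv> lin4 (CD \<gamma> k) u1 u2 u3 u4"
  shows "h w x y z \<oplus>\<^bsub>CD \<gamma> k\<^esub> h w' x' y' z' = h (w + w') (x + x') (y + y') (z + z')"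
    and "r \<odot>\<^bsub>CD \<gamma> k\<^esub> h w x y z = h (r * w) (r * x) (r * y) (r * z)"
  unfolding h_def using assms(1-4)
  by (auto intro!: coord_eqI[of _ \<gamma> k] simp: lin4_CD algebra_simps)

text \<open>The combinations form the least subspace containing the four vectors. This computes the
  hull and shows at the same time that it is a subspace.\<close>

lemma Lin_4:
  assumes "u1 \<in> carrier (CD \<gamma> k)" "u2 \<in> carrier (CD \<gamma> k)"
    "u3 \<in> carrier (CD \<gamma> k)" "u4 \<in> carrier (CD \<gamma> k)"
  shows "Lin (CD \<gamma> k) {u1, u2, u3, u4} = {lin4 (CD \<gamma> k) u1 u2 u3 u4 w x y z | w x y z. True}"
    (is "_ = ?T")
    and "lin_subspace (CD \<gamma> k) {lin4 (CD \<gamma> k) u1 u2 u3 u4 w x y z | w x y z. True}"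
proof -
  let ?h = "lin4 (CD \<gamma> k) u1 u2 u3 u4"
  have "\<zero>\<^bsub>CD \<gamma> k\<^esub> = ?h 0 0 0 0" "u1 = ?h 1 0 0 0" "u2 = ?h 0 1 0 0" "u3 = ?h 0 0 1 0"
    "u4 = ?h 0 0 0 1"
    using assms by (auto intro!: coord_eqI[of _ \<gamma> k] simp: lin4_CD)
  then have mem: "\<zero>\<^bsub>CD \<gamma> k\<^esub> \<in> ?T" "{u1, u2, u3, u4} \<subseteq> ?T" by blast+
  show sub: "lin_subspace (CD \<gamma> k) ?T"
    unfolding lin_subspace_def
  proof (intro conjI ballI allI)
    show "?T \<subseteq> carrier (CD \<gamma> k)" using assms lin4_closed by blast
    show "\<zero>\<^bsub>CD \<gamma> k\<^esub> \<in> ?T" by (rule mem)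
    show "s \<oplus>\<^bsub>CD \<gamma> k\<^esub> t \<in> ?T" if st: "s \<in> ?T" "t \<in> ?T" for s t
    proof -
      obtain w x y z where "s = ?h w x y z" using st(1) by blast
      moreover obtain w' x' y' z' where "t = ?h w' x' y' z'" using st(2) by blast
      ultimately have "s \<oplus>\<^bsub>CD \<gamma> k\<^esub> t = ?h (w + w') (x + x') (y + y') (z + z')"
        by (simp only: lin4_linear(1)[OF assms])
      then show ?thesis by blast
    qed
    show "r \<odot>\<^bsub>CD \<gamma> k\<^esub> s \<in> ?T" if s: "s \<in> ?T" for r s
    proof -
      obtain w x y z where "s = ?h w x y z" using s by blast
      then have "r \<odot>\<^bsub>CD \<gamma> k\<^esub> s = ?h (r * w) (r * x) (r * y) (r * z)"
        by (simp only: lin4_linear(2)[OF assms])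
      then show ?thesis by blast
    qed
  qed
  show "Lin (CD \<gamma> k) {u1, u2, u3, u4} = ?T"
    unfolding Lin_def
  proof (rule hull_unique)
    show "{u1, u2, u3, u4} \<subseteq> ?T" "lin_subspace (CD \<gamma> k) ?T" by (rule mem sub)+
  next
    fix V assume V: "{u1, u2, u3, u4} \<subseteq> V" "lin_subspace (CD \<gamma> k) V"
    then have "?h w x y z \<in> V" for w x y z by (simp add: lin_subspace_def lin4_def)
    then show "?T \<subseteq> V" by blast
  qed
qed

section \<open>The four-dimensional algebra\<close>

text \<open>Coordinates with respect to \<open>1, i, j, ij\<close>, where
  \<open>i = (e\<^sub>1, 0)\<close>, \<open>j = (0, e\<^sub>0)\<close> and
  \<open>ij = (0, e\<^sub>1)\<close>. The order matches
  \<open>e\<^sub>0, a, e\<^sub>0~, a~\<close>.\<close>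

definition quat :: "real \<Rightarrow> real \<Rightarrow> real \<Rightarrow> real \<Rightarrow> cd" where
  "quat w x y z = CD_Pair (CD_Pair (CD_Real w) (CD_Real x)) (CD_Pair (CD_Real y) (CD_Real z))"

text \<open>This is the generalized quaternion algebra with \<open>i i = \<alpha>\<close>,
  \<open>j j = \<beta>\<close>, \<open>j i = - i j\<close>, where zero parameters are allowed. The
  list is only read at positions 0 and 1.\<close>

lemma CD_2_quat:
  fixes \<alpha> \<beta> :: real
  defines "Q \<equiv> CD ((!) [\<alpha>, \<beta>]) 2"
  shows "carrier Q = {quat w x y z | w x y z. True}"
    and "quat w x y z \<otimes>\<^bsub>Q\<^esub> quat w' x' y' z' =
      quat (w * w' + \<alpha> * x * x' + \<beta> * y * y' - \<alpha> * \<beta> * z * z')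
        (w * x' + x * w' - \<beta> * y * z' + \<beta> * z * y')
        (w * y' + y * w' + \<alpha> * x * z' - \<alpha> * z * x')
        (w * z' + z * w' + x * y' - y * x')"
    and "quat w x y z \<oplus>\<^bsub>Q\<^esub> quat w' x' y' z' = quat (w + w') (x + x') (y + y') (z + z')"
    and "r \<odot>\<^bsub>Q\<^esub> quat w x y z = quat (r * w) (r * x) (r * y) (r * z)"
    and "\<one>\<^bsub>Q\<^esub> = quat 1 0 0 0"
  unfolding Q_def
  by (auto simp: numeral_2_eq_2 cd_base_def cd_double_def quat_def algebra_simps)

text \<open>A polynomial identity in the twelve coordinates, valid for all real parameters and hence
  also when \<open>n(a) = 0\<close>.\<close>

lemma associative_on_CD_2:
  "associative_on (CD ((!) [\<alpha>, \<beta>]) 2) (carrier (CD ((!) [\<alpha>, \<beta>]) 2))"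
  unfolding associative_on_def CD_2_quat(1)
  by (auto simp: CD_2_quat(2)) (auto simp: quat_def algebra_simps)

text \<open>The coefficients are those of the product of quaternions in \<open>CD_2_quat(2)\<close>,
  so multiplicativity of the homomorphism becomes a substitution.\<close>

lemma lin4_doubly_pure_mult:
  fixes \<gamma> :: "nat \<Rightarrow> real" and m :: nat and a :: cd
  assumes "doubly_pure \<gamma> (Suc m) a"
  defines "\<alpha> \<equiv> - cd_norm (CD \<gamma> (Suc m)) a" and "\<beta> \<equiv> \<gamma> m"
  defines "h \<equiv> lin4 (CD \<gamma> (Suc m)) \<one>\<^bsub>CD \<gamma> (Suc m)\<^esub> a (e0_tilde \<gamma> (Suc m)) (tilde \<gamma> (Suc m) a)"
  shows "h w x y z \<otimes>\<^bsub>CD \<gamma> (Suc m)\<^esub> h w' x' y' z' =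
      h (w * w' + \<alpha> * x * x' + \<beta> * y * y' - \<alpha> * \<beta> * z * z')
        (w * x' + x * w' - \<beta> * y * z' + \<beta> * z * y')
        (w * y' + y * w' + \<alpha> * x * z' - \<alpha> * z * x')
        (w * z' + z * w' + x * y' - y * x')"
proof -
  let ?A = "CD \<gamma> m"
  obtain b c where a: "a = CD_Pair b c" and [simp]: "b \<in> carrier ?A" "c \<in> carrier ?A"
    and "cd_Re ?A b = \<zero>\<^bsub>?A\<^esub>" "cd_Re ?A c = \<zero>\<^bsub>?A\<^esub>"
    using assms(1) by (auto simp: doubly_pure_def cd_double_def)
  then have [simp]: "star ?A b = (-1) \<odot>\<^bsub>?A\<^esub> b" "star ?A c = (-1) \<odot>\<^bsub>?A\<^esub> c"
    by (auto intro: star_pure)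
  have "a \<in> carrier (CD \<gamma> (Suc m))" using assms(1) by (simp add: doubly_pure_def)
  \<comment> \<open>First component of \<open>a a* = n(a) e\<^sub>0\<close>, with
    \<open>b* = -b\<close> and \<open>(-c)* = -(-c)\<close>. Solved for \<open>b b\<close>, it reads
    \<open>b b = \<beta> (c c) + \<alpha> e\<^sub>0\<close>; after this substitution the
    \<open>c c\<close> terms of a product cancel too.\<close>
  from mult_star_eq_norm[OF this]
  have "b \<otimes>\<^bsub>?A\<^esub> ((-1) \<odot>\<^bsub>?A\<^esub> b) \<oplus>\<^bsub>?A\<^esub> \<beta> \<odot>\<^bsub>?A\<^esub> (((-1) \<odot>\<^bsub>?A\<^esub> ((-1) \<odot>\<^bsub>?A\<^esub> c)) \<otimes>\<^bsub>?A\<^esub> c)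
      = (- \<alpha>) \<odot>\<^bsub>?A\<^esub> \<one>\<^bsub>?A\<^esub>" (is "?l = ?r")
    by (simp add: cd_double_def a \<alpha>_def \<beta>_def)
  then have "coord ?l p = coord ?r p" for p by simp
  then have bb: "coord (b \<otimes>\<^bsub>?A\<^esub> b) p = \<beta> * coord (c \<otimes>\<^bsub>?A\<^esub> c) p + \<alpha> * coord \<one>\<^bsub>?A\<^esub> p" for p
    by (simp add: algebra_simps)
  \<comment> \<open>The coefficients of \<open>z\<close> come from
    \<open>a~ = (b, c)(0, e\<^sub>0) = (\<beta> c, b)\<close>.\<close>
  have h: "h w x y z = CD_Pair
      ((w \<odot>\<^bsub>?A\<^esub> \<one>\<^bsub>?A\<^esub> \<oplus>\<^bsub>?A\<^esub> x \<odot>\<^bsub>?A\<^esub> b) \<oplus>\<^bsub>?A\<^esub> (z * \<beta>) \<odot>\<^bsub>?A\<^esub> c)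
      ((y \<odot>\<^bsub>?A\<^esub> \<one>\<^bsub>?A\<^esub> \<oplus>\<^bsub>?A\<^esub> x \<odot>\<^bsub>?A\<^esub> c) \<oplus>\<^bsub>?A\<^esub> z \<odot>\<^bsub>?A\<^esub> b)" for w x y z
    by (auto simp: h_def lin4_def e0_tilde_def tilde_def cd_double_def a \<beta>_def
        intro!: coord_eqI[of _ \<gamma> m])
  show ?thesis
    unfolding h
    by (auto simp: cd_double_def simp flip: \<beta>_def intro!: coord_eqI[of _ \<gamma> m])
      (simp_all add: bb algebra_simps)
qed

section \<open>The homomorphism onto \<open>H_set\<close> and its consequences\<close>

theorem lemma5p3:
  fixes \<gamma> :: "nat \<Rightarrow> real" and n :: nat and a :: cd
  assumes "\<And>i. \<gamma> i \<noteq> 0"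
    and "n \<ge> 1"
    and "doubly_pure \<gamma> n a"
  shows "(\<exists>\<phi>. \<phi> \<in> alg_hom (CD ((!) [- cd_norm (CD \<gamma> n) a, \<gamma> (n - 1)]) 2)
                        ((CD \<gamma> n)\<lparr>carrier := H_set \<gamma> n a\<rparr>) \<and>
              \<phi> ` carrier (CD ((!) [- cd_norm (CD \<gamma> n) a, \<gamma> (n - 1)]) 2) = H_set \<gamma> n a) \<and>
         unital_subalgebra (CD \<gamma> n) (H_set \<gamma> n a) \<and>
         associative_on (CD \<gamma> n) (H_set \<gamma> n a)"
proof -
  obtain m where n: "n = Suc m" using assms(2) by (cases n) auto
  let ?B = "CD \<gamma> n" and ?H = "H_set \<gamma> n a"
  let ?Q = "CD ((!) [- cd_norm (CD \<gamma> n) a, \<gamma> (n - 1)]) 2"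
  define h where "h = lin4 ?B \<one>\<^bsub>?B\<^esub> a (e0_tilde \<gamma> n) (tilde \<gamma> n a)"
  have a: "a \<in> carrier ?B" using assms(3) by (simp add: doubly_pure_def)
  have e: "e0_tilde \<gamma> n \<in> carrier ?B" by (simp add: n e0_tilde_def cd_double_def)
  have t: "tilde \<gamma> n a \<in> carrier ?B" using a e by (simp add: tilde_def)
  note basis = CD_closed(1)[of \<gamma> n] a e t
  have H: "?H = {h w x y z | w x y z. True}" and sub: "lin_subspace ?B ?H"
    using Lin_4[OF basis] by (simp_all add: H_set_def h_def)
  have one: "\<one>\<^bsub>?B\<^esub> = h 1 0 0 0"
    using basis by (auto intro!: coord_eqI[of _ \<gamma> n] simp: h_def lin4_CD)
  have "n - 1 = m" by (simp add: n)
  note mult = lin4_doubly_pure_mult[OF assms(3)[unfolded n], folded n \<open>n - 1 = m\<close>, folded h_def]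
  note lin = lin4_linear[OF basis, folded h_def]
  \<comment> \<open>The four leaves of a tree of depth 2 are its coordinates; only such trees
    matter. Reading coefficients in the source keeps the map well defined even if
    \<open>e\<^sub>0, a, e\<^sub>0~, a~\<close> are dependent.\<close>
  define \<phi> where "\<phi> q = h (cd_val (cd_fst (cd_fst q))) (cd_val (cd_snd (cd_fst q)))
    (cd_val (cd_fst (cd_snd q))) (cd_val (cd_snd (cd_snd q)))" for q
  have \<phi>: "\<phi> (quat w x y z) = h w x y z" for w x y z by (simp add: \<phi>_def quat_def)
  have surj: "\<phi> ` carrier ?Q = ?H"
    unfolding H CD_2_quat(1) by (force simp: \<phi> image_iff)
  have \<phi>_mult: "\<phi> (p \<otimes>\<^bsub>?Q\<^esub> q) = \<phi> p \<otimes>\<^bsub>?B\<^esub> \<phi> q"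
    if "p \<in> carrier ?Q" "q \<in> carrier ?Q" for p q
    using that by (auto simp: CD_2_quat(1,2) \<phi> mult)
  have closed: "p \<otimes>\<^bsub>?Q\<^esub> q \<in> carrier ?Q"
    if "p \<in> carrier ?Q" "q \<in> carrier ?Q" for p q
    using that by (rule CD_closed)
  have hom: "\<phi> \<in> alg_hom ?Q (?B\<lparr>carrier := ?H\<rparr>)"
    unfolding alg_hom_def
  proof (intro CollectI conjI ring_hom_memI allI ballI)
    show "\<phi> p \<in> carrier (?B\<lparr>carrier := ?H\<rparr>)" if "p \<in> carrier ?Q" for p
      using that surj by auto
    show "\<phi> \<one>\<^bsub>?Q\<^esub> = \<one>\<^bsub>?B\<lparr>carrier := ?H\<rparr>\<^esub>" by (simp add: CD_2_quat(5) \<phi> one)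
  next
    fix p q assume pq: "p \<in> carrier ?Q" "q \<in> carrier ?Q"
    show "\<phi> (p \<otimes>\<^bsub>?Q\<^esub> q) = \<phi> p \<otimes>\<^bsub>?B\<lparr>carrier := ?H\<rparr>\<^esub> \<phi> q" using \<phi>_mult[OF pq] by simp
    show "\<phi> (p \<oplus>\<^bsub>?Q\<^esub> q) = \<phi> p \<oplus>\<^bsub>?B\<lparr>carrier := ?H\<rparr>\<^esub> \<phi> q"
      using pq lin(1) by (auto simp: CD_2_quat(1,3) \<phi>)
  next
    fix r p assume "p \<in> carrier ?Q"
    then show "\<phi> (r \<odot>\<^bsub>?Q\<^esub> p) = r \<odot>\<^bsub>?B\<lparr>carrier := ?H\<rparr>\<^esub> \<phi> p"
      using lin(2) by (auto simp: CD_2_quat(1,4) \<phi>)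
  qed
  have "unital_subalgebra ?B ?H"
    unfolding unital_subalgebra_def
  proof (intro conjI ballI)
    show "\<one>\<^bsub>?B\<^esub> \<in> ?H" unfolding H one by blast
    show "s \<otimes>\<^bsub>?B\<^esub> t \<in> ?H" if st: "s \<in> ?H" "t \<in> ?H" for s t
    proof -
      \<comment> \<open>Products in the image are pulled back to \<open>?Q\<close>, whose carrier is
        closed under multiplication.\<close>
      obtain p q where "p \<in> carrier ?Q" "s = \<phi> p" "q \<in> carrier ?Q" "t = \<phi> q"
        using st surj by blast
      then show ?thesis using closed surj \<phi>_mult by (metis imageI)
    qed
  qed (rule sub)
  moreover have "associative_on ?B ?H"
    unfolding associative_on_def
  proof (intro ballI)
    fix s t u assume "s \<in> ?H" "t \<in> ?H" "u \<in> ?H"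
    then obtain p q r where pqr: "p \<in> carrier ?Q" "q \<in> carrier ?Q" "r \<in> carrier ?Q"
      and stu: "s = \<phi> p" "t = \<phi> q" "u = \<phi> r"
      unfolding surj[symmetric] by blast
    \<comment> \<open>Associativity holds for the preimages and is carried over by
      \<open>\<phi>_mult\<close>.\<close>
    have "(p \<otimes>\<^bsub>?Q\<^esub> q) \<otimes>\<^bsub>?Q\<^esub> r = p \<otimes>\<^bsub>?Q\<^esub> (q \<otimes>\<^bsub>?Q\<^esub> r)"
      using associative_on_CD_2 pqr by (simp add: associative_on_def)
    then show "(s \<otimes>\<^bsub>?B\<^esub> t) \<otimes>\<^bsub>?B\<^esub> u = s \<otimes>\<^bsub>?B\<^esub> (t \<otimes>\<^bsub>?B\<^esub> u)"
      unfolding stu by (metis \<phi>_mult closed pqr)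
  qed
  ultimately show ?thesis using hom surj by blast
qed

end
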